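(* Let $(A,\omega)$ be an anti-pre-Lie algebra. If two $1$-parameter formal deformations $\omega_t'=\omega+\sum_{i=1}^{+\infty}\omega_i't^i$ and $\omega_t=\omega+\sum_{i=1}^{+\infty}\omega_it^i$ of $(A,\omega)$ are equivalent, then the infinitesimals $\omega_1'$ and $\omega_1$ are in the same cohomology class of $H^2(A;A)$.
   Context: Let $\mathbb K$ be the ground field. An anti-pre-Lie algebra is a vector space (or $\mathbb K[[t]]$-module) $A$ with a bilinear product $\cdot$ such that for all $x,y,z$, with $[x,y]=x\cdot y-y\cdot x$: (1) $x\cdot(y\cdot z)-y\cdot(x\cdot z)=[y,x]\cdot z$; (2) $[x,y]\cdot z+[y,z]\cdot x+[z,x]\cdot y=0$. The product is also written $\omega(x,y)=x\cdot y$. A $1$-parameter formal deformation of $(A,\omega)$ is a $\mathbb K[[t]]$-bilinear map $\omega_t=\omega+\sum_{i\ge1}\omega_it^i:A[[t]]\otimes A[[t]]\to A[[t]]$, where each $\omega_i:A\otimes A\to A$ is linear (and $\omega_0=\omega$), i.e. $\omega_t(\sum_i a_it^i,\sum_j b_jt^j)=\sum_{i,j,k}\omega_k(a_i,b_j)t^{i+j+k}$, such that $(A[[t]],\omega_t)$ is an anti-pre-Lie algebra. Its infinitesimal is $\omega_1$, which is a 2-cocycle in the sense below. Two formal deformations $\omega'_t,\omega_t$ are equivalent if there is a formal isomorphism from $(A[[t]],\omega_t')$ to $(A[[t]],\omega_t)$, i.e. a power series $\Phi_t=\sum_{i\ge0}\varphi_it^i$ with $\varphi_i:A\to A$ linear,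 $\varphi_0=\mathrm{Id}$, such that $\Phi_t\circ\omega'_t=\omega_t\circ(\Phi_t\otimes\Phi_t)$. Cohomology with coefficients in the regular representation $(A,L,R)$, $L_xy=x\cdot y$, $R_xy=y\cdot x$: $Z^2(A;A)$ is the space of linear maps $f:A\otimes A\to A$ such that for all $x,y,z\in A$, $x\cdot f(y,z)-y\cdot f(x,z)-f(y,x)\cdot z+f(x,y)\cdot z-f(y,x\cdot z)+f(x,y\cdot z)+f([x,y],z)=0$ and $(f(y,z)-f(z,y))\cdot x+(f(z,x)-f(x,z))\cdot y+(f(x,y)-f(y,x))\cdot z+f([x,y],z)+f([y,z],x)+f([z,x],y)=0$. $B^2(A;A)$ is the space of maps $\mathrm d^1\varphi(x,y)=x\cdot\varphi(y)+\varphi(x)\cdot y-\varphi(x\cdot y)$ with $\varphi:A\to A$ linear; $B^2(A;A)\subset Z^2(A;A)$ and $H^2(A;A)=Z^2(A;A)/B^2(A;A)$. *)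

theory Defs
  imports "HOL-Computational_Algebra.Formal_Power_Series"
begin

section \<open>Anti-pre-Lie algebras\<close>

definition bilinear_op :: "('r::comm_ring_1 \<Rightarrow> 'v::ab_group_add \<Rightarrow> 'v) \<Rightarrow> ('v \<Rightarrow> 'v \<Rightarrow> 'v) \<Rightarrow> bool"
  where "bilinear_op scale f \<longleftrightarrow>
    (\<forall>x. module_hom scale scale (\<lambda>y. f x y)) \<and> (\<forall>y. module_hom scale scale (\<lambda>x. f x y))"

definition commutator :: "('v::ab_group_add \<Rightarrow> 'v \<Rightarrow> 'v) \<Rightarrow> 'v \<Rightarrow> 'v \<Rightarrow> 'v"
  where "commutator mul x y = mul x y - mul y x"

text \<open>The scalars form a commutative ring, so that the same notion covers algebras over the
  ground field \<open>K\<close> and over the ring \<open>K[[t]]\<close>.\<close>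

locale anti_pre_lie_algebra = module scale
  for scale :: "'r::comm_ring_1 \<Rightarrow> 'v::ab_group_add \<Rightarrow> 'v" +
  fixes mul :: "'v \<Rightarrow> 'v \<Rightarrow> 'v"
  assumes bilinear_mul: "bilinear_op scale mul"
    and left_commutator:
      "mul x (mul y z) - mul y (mul x z) = mul (commutator mul y x) z"
    and cyclic:
      "mul (commutator mul x y) z + mul (commutator mul y z) x + mul (commutator mul z x) y = 0"


section \<open>Formal deformations\<close>

text \<open>An element \<open>\<Sum>i. a\<^sub>i t\<^sup>i\<close> of \<open>A[[t]]\<close> is represented by an element of \<^typ>\<open>'v fps\<close>, where
  \<^typ>\<open>'v\<close> is the type of elements of \<open>A\<close>; \<open>A[[t]]\<close> is a module over \<open>K[[t]]\<close>, i.e. over \<open>'k fps\<close>,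
  by the Cauchy product.\<close>

definition fps_scale :: "('k::field \<Rightarrow> 'v::ab_group_add \<Rightarrow> 'v) \<Rightarrow> 'k fps \<Rightarrow> 'v fps \<Rightarrow> 'v fps"
  where "fps_scale scale c a =
    Abs_fps (\<lambda>n. \<Sum>i=0..n. scale (fps_nth c i) (fps_nth a (n - i)))"

text \<open>\<open>\<omega>\<^sub>t = \<Sum>k. \<omega>\<^sub>k t\<^sup>k\<close>: the coefficient at \<open>t\<^sup>n\<close> is the sum of \<open>\<omega>\<^sub>k(a\<^sub>i, b\<^sub>j)\<close> over \<open>i + j + k = n\<close>.\<close>

definition series_product ::
    "(nat \<Rightarrow> 'v::ab_group_add \<Rightarrow> 'v \<Rightarrow> 'v) \<Rightarrow> 'v fps \<Rightarrow> 'v fps \<Rightarrow> 'v fps"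
  where "series_product \<omega> a b =
    Abs_fps (\<lambda>n. \<Sum>i=0..n. \<Sum>j=0..n-i. \<omega> (n - i - j) (fps_nth a i) (fps_nth b j))"

text \<open>\<open>\<Phi>\<^sub>t = \<Sum>i. \<phi>\<^sub>i t\<^sup>i\<close> as a map on \<open>A[[t]]\<close>.\<close>

definition series_map :: "(nat \<Rightarrow> 'v::ab_group_add \<Rightarrow> 'v) \<Rightarrow> 'v fps \<Rightarrow> 'v fps"
  where "series_map \<phi> a = Abs_fps (\<lambda>n. \<Sum>i=0..n. \<phi> i (fps_nth a (n - i)))"

definition formal_deformation ::
    "('k::field \<Rightarrow> 'v::ab_group_add \<Rightarrow> 'v) \<Rightarrow> ('v \<Rightarrow> 'v \<Rightarrow> 'v) \<Rightarrow> (nat \<Rightarrow> 'v \<Rightarrow> 'v \<Rightarrow> 'v) \<Rightarrow> bool"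
  where "formal_deformation scale mul \<omega> \<longleftrightarrow>
    \<omega> 0 = mul \<and>
    (\<forall>i. bilinear_op scale (\<omega> i)) \<and>
    anti_pre_lie_algebra (fps_scale scale) (series_product \<omega>)"

definition infinitesimal :: "(nat \<Rightarrow> 'v \<Rightarrow> 'v \<Rightarrow> 'v) \<Rightarrow> 'v \<Rightarrow> 'v \<Rightarrow> 'v"
  where "infinitesimal \<omega> = \<omega> 1"

definition formal_isomorphism ::
    "('k::field \<Rightarrow> 'v::ab_group_add \<Rightarrow> 'v) \<Rightarrow> (nat \<Rightarrow> 'v \<Rightarrow> 'v \<Rightarrow> 'v) \<Rightarrow> (nat \<Rightarrow> 'v \<Rightarrow> 'v \<Rightarrow> 'v) \<Rightarrow>
      (nat \<Rightarrow> 'v \<Rightarrow> 'v) \<Rightarrow> bool"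
  where "formal_isomorphism scale \<omega>' \<omega> \<phi> \<longleftrightarrow>
    (\<forall>i. module_hom scale scale (\<phi> i)) \<and>
    \<phi> 0 = id \<and>
    (\<forall>a b. series_map \<phi> (series_product \<omega>' a b) =
      series_product \<omega> (series_map \<phi> a) (series_map \<phi> b))"

definition equivalent_deformations ::
    "('k::field \<Rightarrow> 'v::ab_group_add \<Rightarrow> 'v) \<Rightarrow> (nat \<Rightarrow> 'v \<Rightarrow> 'v \<Rightarrow> 'v) \<Rightarrow> (nat \<Rightarrow> 'v \<Rightarrow> 'v \<Rightarrow> 'v) \<Rightarrow> bool"
  where "equivalent_deformations scale \<omega>' \<omega> \<longleftrightarrow> (\<exists>\<phi>. formal_isomorphism scale \<omega>' \<omega> \<phi>)"


section \<open>The second cohomology with coefficients in the regular representation\<close>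

text \<open>Linear maps \<open>A \<otimes> A \<rightarrow> A\<close> are represented by bilinear maps.\<close>

definition cocycles2 ::
    "('k::field \<Rightarrow> 'v::ab_group_add \<Rightarrow> 'v) \<Rightarrow> ('v \<Rightarrow> 'v \<Rightarrow> 'v) \<Rightarrow> ('v \<Rightarrow> 'v \<Rightarrow> 'v) set"
  where "cocycles2 scale mul = {f. bilinear_op scale f \<and>
    (\<forall>x y z. mul x (f y z) - mul y (f x z) - mul (f y x) z + mul (f x y) z
        - f y (mul x z) + f x (mul y z) + f (commutator mul x y) z = 0) \<and>
    (\<forall>x y z. mul (f y z - f z y) x + mul (f z x - f x z) y + mul (f x y - f y x) z
        + f (commutator mul x y) z + f (commutator mul y z) x + f (commutator mul z x) y = 0)}"

definition d1 :: "('v::ab_group_add \<Rightarrow> 'v \<Rightarrow> 'v) \<Rightarrow> ('v \<Rightarrow> 'v) \<Rightarrow> 'v \<Rightarrow> 'v \<Rightarrow> 'v"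
  where "d1 mul \<phi> x y = mul x (\<phi> y) + mul (\<phi> x) y - \<phi> (mul x y)"

definition coboundaries2 ::
    "('k::field \<Rightarrow> 'v::ab_group_add \<Rightarrow> 'v) \<Rightarrow> ('v \<Rightarrow> 'v \<Rightarrow> 'v) \<Rightarrow> ('v \<Rightarrow> 'v \<Rightarrow> 'v) set"
  where "coboundaries2 scale mul = {d1 mul \<phi> | \<phi>. module_hom scale scale \<phi>}"

definition cohomologous2 ::
    "('k::field \<Rightarrow> 'v::ab_group_add \<Rightarrow> 'v) \<Rightarrow> ('v \<Rightarrow> 'v \<Rightarrow> 'v) \<Rightarrow>
      (('v \<Rightarrow> 'v \<Rightarrow> 'v) \<times> ('v \<Rightarrow> 'v \<Rightarrow> 'v)) set"
  where "cohomologous2 scale mul = {(f, g). f \<in> cocycles2 scale mul \<and> g \<in> cocycles2 scale mul \<and>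
    (\<lambda>x y. f x y - g x y) \<in> coboundaries2 scale mul}"

definition cohomology2 ::
    "('k::field \<Rightarrow> 'v::ab_group_add \<Rightarrow> 'v) \<Rightarrow> ('v \<Rightarrow> 'v \<Rightarrow> 'v) \<Rightarrow> ('v \<Rightarrow> 'v \<Rightarrow> 'v) set set"
  where "cohomology2 scale mul = cocycles2 scale mul // cohomologous2 scale mul"


section \<open>Well-definedness\<close>

lemma module_fps_scale:
  assumes "vector_space scale"
  shows "module (fps_scale scale)"
proof -
  interpret vector_space scale by fact
  show ?thesis
  proof
    fix a b :: "'a fps" and x y :: "'b fps"
    show "fps_scale scale a (x + y) = fps_scale scale a x + fps_scale scale a y"
      by (simp add: fps_scale_def fps_eq_iff scale_right_distrib sum.distrib)
    show "fps_scale scale (a + b) x = fps_scale scale a x + fps_scale scale b x"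
      by (simp add: fps_scale_def fps_eq_iff scale_left_distrib sum.distrib)
    show "fps_scale scale a (fps_scale scale b x) = fps_scale scale (a * b) x"
      using fps_mult_assoc_lemma[where f = "\<lambda>i j k. scale (fps_nth a i * fps_nth b j) (fps_nth x k)"]
      by (simp add: fps_scale_def fps_eq_iff fps_mult_nth scale_sum_left scale_sum_right)
    show "fps_scale scale 1 x = x"
    proof (rule fps_ext)
      fix n
      have "(\<Sum>i=0..n. scale (fps_nth 1 i) (fps_nth x (n - i))) =
            (\<Sum>i=0..n. if i = 0 then fps_nth x n else 0)"
        by (rule sum.cong) auto
      then show "fps_nth (fps_scale scale 1 x) n = fps_nth x n"
        by (simp add: fps_scale_def)
    qed
  qed
qed

lemma equiv_cohomologous2:
  assumes "anti_pre_lie_algebra scale mul"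
  shows "equiv (cocycles2 scale mul) (cohomologous2 scale mul)"
proof -
  interpret anti_pre_lie_algebra scale mul by fact
  have r: "mul x 0 = 0" "mul x (a + b) = mul x a + mul x b" "mul x (- a) = - mul x a" for x a b
    using bilinear_mul module_hom.zero module_hom.add module_hom.neg
    unfolding bilinear_op_def by blast+
  have l: "mul 0 x = 0" "mul (a + b) x = mul a x + mul b x" "mul (- a) x = - mul a x" for x a b
    using bilinear_mul module_hom.zero[of scale scale "\<lambda>y. mul y x"]
      module_hom.add[of scale scale "\<lambda>y. mul y x"] module_hom.neg[of scale scale "\<lambda>y. mul y x"]
    unfolding bilinear_op_def by blast+
  interpret P: module_pair scale scale by unfold_locales
  have zero: "(\<lambda>x y. 0) \<in> coboundaries2 scale mul"
  proof -
    have "d1 mul (\<lambda>x. 0) = (\<lambda>x y. 0)" by (simp add: d1_def fun_eq_iff r l)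
    then show ?thesis unfolding coboundaries2_def using P.module_hom_zero by force
  qed
  have neg: "(\<lambda>x y. - f x y) \<in> coboundaries2 scale mul"
    if "f \<in> coboundaries2 scale mul" for f
  proof -
    from that obtain \<phi> where \<phi>: "module_hom scale scale \<phi>" "f = d1 mul \<phi>"
      by (auto simp: coboundaries2_def)
    have "d1 mul (\<lambda>x. - \<phi> x) = (\<lambda>x y. - f x y)"
      by (simp add: d1_def fun_eq_iff r l \<phi>(2))
    then show ?thesis unfolding coboundaries2_def using P.module_hom_neg[OF \<phi>(1)] by force
  qed
  have add: "(\<lambda>x y. f x y + g x y) \<in> coboundaries2 scale mul"
    if fg: "f \<in> coboundaries2 scale mul" "g \<in> coboundaries2 scale mul" for f g
  proof -
    from fg obtain \<phi> \<psi> where \<phi>: "module_hom scale scale \<phi>" "f = d1 mul \<phi>"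
      and \<psi>: "module_hom scale scale \<psi>" "g = d1 mul \<psi>"
      by (auto simp: coboundaries2_def)
    have "d1 mul (\<lambda>x. \<phi> x + \<psi> x) = (\<lambda>x y. f x y + g x y)"
      by (simp add: d1_def fun_eq_iff r l \<phi>(2) \<psi>(2))
    then show ?thesis unfolding coboundaries2_def using P.module_hom_add[OF \<phi>(1) \<psi>(1)] by force
  qed
  show ?thesis
  proof (rule equivI)
    show "refl_on (cocycles2 scale mul) (cohomologous2 scale mul)"
      using zero by (auto simp: refl_on_def cohomologous2_def)
    show "cohomologous2 scale mul \<subseteq> cocycles2 scale mul \<times> cocycles2 scale mul"
      by (auto simp: cohomologous2_def)
    show "sym (cohomologous2 scale mul)"
      by (rule symI) (auto simp: cohomologous2_def dest: neg)
    show "trans (cohomologous2 scale mul)"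
      by (rule transI) (auto simp: cohomologous2_def dest: add)
  qed
qed

end

theory Submission
  imports Defs
begin

text \<open>Restrict the identities of the deformed algebra to constant power series and compare the
  coefficients at \<open>t\<close>: the two defining identities give the two cocycle conditions for
  \<open>\<omega>\<^sub>1\<close>, and \<open>\<Phi>\<^sub>t \<circ> \<omega>'\<^sub>t = \<omega>\<^sub>t \<circ> (\<Phi>\<^sub>t \<otimes> \<Phi>\<^sub>t)\<close> gives \<open>\<omega>'\<^sub>1 - \<omega>\<^sub>1 = d\<^sup>1 \<phi>\<^sub>1\<close>.\<close>

lemma series_product_nth_0 [simp]:
  "fps_nth (series_product \<omega> a b) 0 = \<omega> 0 (fps_nth a 0) (fps_nth b 0)"
  by (simp add: series_product_def)

text \<open>Exactly one of the three indices in i + j + k = 1 equals 1. The index is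
  \<open>Suc 0\<close>, the form to which the simplifier brings \<open>1\<close>.\<close>

lemma series_product_nth_1 [simp]:
  "fps_nth (series_product \<omega> a b) (Suc 0) =
    \<omega> 1 (fps_nth a 0) (fps_nth b 0) + \<omega> 0 (fps_nth a 0) (fps_nth b 1) +
    \<omega> 0 (fps_nth a 1) (fps_nth b 0)"
  by (simp add: series_product_def add.assoc)

lemma series_map_nth_0 [simp]: "fps_nth (series_map \<phi> a) 0 = \<phi> 0 (fps_nth a 0)"
  by (simp add: series_map_def)

lemma series_map_nth_1 [simp]:
  "fps_nth (series_map \<phi> a) (Suc 0) = \<phi> 0 (fps_nth a 1) + \<phi> 1 (fps_nth a 0)"
  by (simp add: series_map_def)

context
  fixes scale :: "'r::comm_ring_1 \<Rightarrow> 'v::ab_group_add \<Rightarrow> 'v" and f :: "'v \<Rightarrow> 'v \<Rightarrow> 'v"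
  assumes f: "bilinear_op scale f"
begin

lemma bilinear_op_right:
  "f x 0 = 0" "f x (a + b) = f x a + f x b" "f x (a - b) = f x a - f x b"
  using f module_hom.zero module_hom.add module_hom.diff unfolding bilinear_op_def by blast+

lemma bilinear_op_left:
  "f 0 y = 0" "f (a + b) y = f a y + f b y" "f (a - b) y = f a y - f b y"
  using f module_hom.zero[of scale scale "\<lambda>x. f x y"]
    module_hom.add[of scale scale "\<lambda>x. f x y"] module_hom.diff[of scale scale "\<lambda>x. f x y"]
  unfolding bilinear_op_def by blast+

lemmas bilinear_op_simps = bilinear_op_right bilinear_op_left

end

text \<open>Both identities are quadratic in the product, so their first-order parts have one factor
  \<open>\<omega> 1\<close> and one factor \<open>mul\<close>: on constants x(yz) contributes
  \<open>mul x (\<omega> 1 y z) + \<omega> 1 x (mul y z)\<close>.\<close>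

lemma infinitesimal_in_cocycles2:
  assumes "formal_deformation scale mul \<omega>"
  shows "infinitesimal \<omega> \<in> cocycles2 scale mul"
proof -
  have mul: "\<omega> 0 = mul" and bil: "\<And>i. bilinear_op scale (\<omega> i)"
    using assms by (auto simp: formal_deformation_def)
  interpret D: anti_pre_lie_algebra "fps_scale scale" "series_product \<omega>"
    using assms by (simp add: formal_deformation_def)
  \<comment> \<open>Bilinearity removes the terms containing the zero higher coefficients of
    constant series and splits the commutators.\<close>
  note simps = commutator_def mul bilinear_op_simps[OF bil[of 0], unfolded mul]
    bilinear_op_simps[OF bil[of "Suc 0"]]
  have "mul x (\<omega> 1 y z) - mul y (\<omega> 1 x z) - mul (\<omega> 1 y x) z + mul (\<omega> 1 x y) z
      - \<omega> 1 y (mul x z) + \<omega> 1 x (mul y z) + \<omega> 1 (commutator mul x y) z = 0" for x y z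
    \<comment> \<open>The bracket here is [y,x]; moved to the left side, it yields the term
      \<open>\<omega> 1 (commutator mul x y) z\<close> with a plus sign.\<close>
    using D.left_commutator[of "fps_const x" "fps_const y" "fps_const z",
        THEN arg_cong[where f = "\<lambda>s. fps_nth s 1"]]
    by (simp add: simps algebra_simps)
  moreover have "mul (\<omega> 1 y z - \<omega> 1 z y) x + mul (\<omega> 1 z x - \<omega> 1 x z) y + mul (\<omega> 1 x y - \<omega> 1 y x) z
      + \<omega> 1 (commutator mul x y) z + \<omega> 1 (commutator mul y z) x + \<omega> 1 (commutator mul z x) y = 0"
    for x y z
    using D.cyclic[of "fps_const x" "fps_const y" "fps_const z",
        THEN arg_cong[where f = "\<lambda>s. fps_nth s 1"]]
    by (simp add: simps algebra_simps)
  ultimately show ?thesis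
    using bil[of 1] unfolding infinitesimal_def cocycles2_def by blast
qed

text \<open>Since \<open>\<phi> 0 = id\<close>, the coefficients at t on constants are
  \<open>\<omega>' 1 x y + \<phi> 1 (mul x y)\<close> and
  \<open>\<omega> 1 x y + mul x (\<phi> 1 y) + mul (\<phi> 1 x) y\<close>.\<close>

lemma formal_isomorphism_infinitesimal_diff:
  assumes "\<omega>' 0 = mul" and "\<omega> 0 = mul"
    and "formal_isomorphism scale \<omega>' \<omega> \<phi>" and "bilinear_op scale mul"
  shows "infinitesimal \<omega>' x y - infinitesimal \<omega> x y = d1 mul (\<phi> 1) x y"
proof -
  have "\<phi> 0 = id"
    and "series_map \<phi> (series_product \<omega>' (fps_const x) (fps_const y)) =
      series_product \<omega> (series_map \<phi> (fps_const x)) (series_map \<phi> (fps_const y))"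
    using assms(3) by (auto simp: formal_isomorphism_def)
  from this(2)[THEN arg_cong[where f = "\<lambda>s. fps_nth s 1"]] show ?thesis
    by (simp add: infinitesimal_def d1_def assms(1,2) \<open>\<phi> 0 = id\<close>
        bilinear_op_simps[OF assms(4)] algebra_simps)
qed

theorem theorem4p5:
  fixes scale :: "'k::field \<Rightarrow> 'v::ab_group_add \<Rightarrow> 'v"
    and \<omega> :: "'v \<Rightarrow> 'v \<Rightarrow> 'v"
    and \<omega>s' \<omega>s :: "nat \<Rightarrow> 'v \<Rightarrow> 'v \<Rightarrow> 'v"
  assumes "vector_space scale"
    and "anti_pre_lie_algebra scale \<omega>"
    and "formal_deformation scale \<omega> \<omega>s'"
    and "formal_deformation scale \<omega> \<omega>s"
    and "equivalent_deformations scale \<omega>s' \<omega>s"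
  shows "\<exists>C \<in> cohomology2 scale \<omega>. infinitesimal \<omega>s' \<in> C \<and> infinitesimal \<omega>s \<in> C"
proof -
  obtain \<phi> where \<phi>: "formal_isomorphism scale \<omega>s' \<omega>s \<phi>"
    using assms(5) by (auto simp: equivalent_deformations_def)
  note cocycles = assms(3,4)[THEN infinitesimal_in_cocycles2]
  have "(\<lambda>x y. infinitesimal \<omega>s' x y - infinitesimal \<omega>s x y) = d1 \<omega> (\<phi> 1)"
    using formal_isomorphism_infinitesimal_diff[OF _ _ \<phi>] assms(3,4)
      anti_pre_lie_algebra.bilinear_mul[OF assms(2)]
    by (simp add: formal_deformation_def fun_eq_iff)
  moreover have "module_hom scale scale (\<phi> 1)"
    using \<phi> by (simp add: formal_isomorphism_def)
  ultimately have rel: "(infinitesimal \<omega>s', infinitesimal \<omega>s) \<in> cohomologous2 scale \<omega>"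
    using cocycles by (auto simp: cohomologous2_def coboundaries2_def)
  \<comment> \<open>The common class is that of \<open>infinitesimal \<omega>s'\<close>: reflexivity
    puts this cocycle in it, and \<open>rel\<close> the other one.\<close>
  let ?C = "cohomologous2 scale \<omega> `` {infinitesimal \<omega>s'}"
  have "?C \<in> cohomology2 scale \<omega>"
    unfolding cohomology2_def using cocycles(1) by (rule quotientI)
  moreover have "infinitesimal \<omega>s' \<in> ?C"
    using equiv_class_self[OF equiv_cohomologous2[OF assms(2)] cocycles(1)] .
  ultimately show ?thesis
    using rel by blast
qed

end
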